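(* Let $(M,g,I_1,I_2,I_3)$ be a locally conformally hyperkähler manifold whose Lee form $\theta$ is parallel with respect to the Levi-Civita connection of $g$ and has unit length with respect to $g$. Let $\theta_r=I_r\theta$ and let $$\hat g=g-\tfrac12\{\theta\otimes\theta+\theta_1\otimes\theta_1+\theta_2\otimes\theta_2+\theta_3\otimes\theta_3\}$$ be the associated HKT-metric. Let $V$ be the vector field dual to $\theta$ with respect to $g$, let $\hat\theta=\hat g(V,\cdot)$ (so that $\hat\theta=\tfrac12\theta$), let $\hat\theta_r=I_r\hat\theta$, and let $\hat F_r(X,Y)=\hat g(I_rX,Y)$. Then the torsion 3-form $c$ of the HKT-connection of $\hat g$ is $$c=-\left(\hat\theta_1\wedge\hat F_1+\hat\theta_2\wedge\hat F_2+\hat\theta_3\wedge\hat F_3-2\,\hat\theta_1\wedge\hat\theta_2\wedge\hat\theta_3\right).$$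
   Context: A hypercomplex structure on a smooth manifold $M$ is a triple of integrable complex structures $I_1,I_2,I_3$ with $I_1^2=I_2^2=I_3^2=-\mathrm{Id}$ and $I_1I_2=I_3=-I_2I_1$. With a Riemannian metric $g$ satisfying $g(I_rX,I_rY)=g(X,Y)$ for $r=1,2,3$, $(M,g,I_1,I_2,I_3)$ is called hyperhermitian. It is hyperkähler if the Levi-Civita connection $\nabla$ of $g$ satisfies $\nabla I_r=0$ for all $r$. It is locally conformally hyperkähler if there are an open cover $\{U_i\}$ and smooth functions $f_i$ on $U_i$ with $g|_{U_i}=e^{f_i}g_i$, where each $g_i$ is a hyperkähler metric on $U_i$ (with respect to $I_1,I_2,I_3$). The Lee form is the globally defined closed 1-form $\theta$ with $\theta|_{U_i}=df_i$; it satisfies $dF_r=\theta\wedge F_r$ for $F_r(X,Y)=g(I_rX,Y)$. An HKT-connection on a hyperhermitian manifold $(M,\hat g,I_1,I_2,I_3)$ is a linear connection $D$ with torsion tensor $T^D$ such that $D\hat g=0$, $DI_r=0$ for all $r$, and $c(X,Y,Z)=\hat g(T^D(X,Y),Z)$ is a 3-form, called the torsion 3-form. When it exists it is unique, and $\hat g$ is called an HKT-metric. The metric $\hat g$ of the claim is known to be HKT. For a $k$-form $\omega$: $(I_r\omega)(X_1,\dots,X_k)=(-1)^k\omega(I_rX_1,\dots,I_rX_k)$. Wedge products use the convention $\alpha_1\wedge\cdots\wedge\alpha_n(X_1,\dots,X_n)=\det(\alpha_i(X_j))$ for 1-forms $\alpha_i$. *)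

theory Defs
  imports "HOL-Analysis.Analysis"
begin

section \<open>Smooth maps between open subsets of Euclidean spaces\<close>

primrec times_differentiable_on ::
    "nat \<Rightarrow> 'a::euclidean_space set \<Rightarrow> ('a \<Rightarrow> 'b::real_normed_vector) \<Rightarrow> bool" where
  "times_differentiable_on 0 S f \<longleftrightarrow> continuous_on S f"
| "times_differentiable_on (Suc k) S f \<longleftrightarrow>
     (\<forall>x\<in>S. f differentiable (at x)) \<and>
     (\<forall>v. times_differentiable_on k S (\<lambda>x. frechet_derivative f (at x) v))"

text \<open>Only meant for open \<open>S\<close>, as the derivatives are two-sided.\<close>

definition smooth_on :: "'a::euclidean_space set \<Rightarrow> ('a \<Rightarrow> 'b::real_normed_vector) \<Rightarrow> bool" where
  "smooth_on S f \<longleftrightarrow> (\<forall>k. times_differentiable_on k S f)"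


section \<open>Smooth manifolds\<close>

text \<open>
  A chart is a pair of its domain and its coordinate map (whose values off the domain are
  irrelevant). The manifold is a whole type \<open>'m\<close> with a smooth atlas modelled on \<open>'e\<close>. The atlas
  need not be maximal.
\<close>

type_synonym ('m, 'e) chart = "'m set \<times> ('m \<Rightarrow> 'e)"

definition chart_inv :: "('m, 'e) chart \<Rightarrow> 'e \<Rightarrow> 'm" where
  "chart_inv c = inv_into (fst c) (snd c)"

definition transition :: "('m, 'e) chart \<Rightarrow> ('m, 'e) chart \<Rightarrow> 'e \<Rightarrow> 'e" where
  "transition c d = snd d \<circ> chart_inv c"

definition smooth_manifold ::
    "('m::{t2_space, second_countable_topology}, 'e::euclidean_space) chart set \<Rightarrow> bool" where
  "smooth_manifold A \<longleftrightarrow>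
     (\<forall>c\<in>A. open (fst c) \<and> open (snd c ` fst c) \<and>
        homeomorphism (fst c) (snd c ` fst c) (snd c) (chart_inv c)) \<and>
     (\<Union>c\<in>A. fst c) = UNIV \<and>
     (\<forall>c\<in>A. \<forall>d\<in>A. smooth_on (snd c ` (fst c \<inter> fst d)) (transition c d))"

text \<open>
  Every tangent space \<open>T\<^sub>pM\<close> is represented by a copy of the model space \<open>'e\<close>: a vector \<open>v\<close> at \<open>p\<close>
  stands for the tangent vector whose components in the chosen chart \<open>chart_at A p\<close> are \<open>v\<close>. As
  that chart may jump with \<open>p\<close>, regularity of fields is always tested on the
  components with respect to one fixed chart.
\<close>

definition chart_at :: "('m, 'e) chart set \<Rightarrow> 'm \<Rightarrow> ('m, 'e) chart" where
  "chart_at A p = (SOME c. c \<in> A \<and> p \<in> fst c)"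

definition tangent_change ::
    "('m, 'e::euclidean_space) chart \<Rightarrow> ('m, 'e) chart \<Rightarrow> 'm \<Rightarrow> 'e \<Rightarrow> 'e" where
  "tangent_change c d p = frechet_derivative (transition c d) (at (snd c p))"

text \<open>The components in the chart \<open>c\<close> of a tangent vector at \<open>p\<close>, and the inverse operation.\<close>

definition components ::
    "('m, 'e::euclidean_space) chart set \<Rightarrow> ('m, 'e) chart \<Rightarrow> 'm \<Rightarrow> 'e \<Rightarrow> 'e" where
  "components A c p v = tangent_change (chart_at A p) c p v"

definition coord_field ::
    "('m, 'e::euclidean_space) chart set \<Rightarrow> ('m, 'e) chart \<Rightarrow> 'e \<Rightarrow> 'm \<Rightarrow> 'e" where
  "coord_field A c v p = tangent_change c (chart_at A p) p v"


section \<open>Functions and vector fields on an open subset\<close>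

text \<open>
  In what follows \<open>U\<close> is an open subset of the manifold. Objects living on \<open>U\<close> are total functions
  whose values off \<open>U\<close> are irrelevant.
\<close>

definition smooth_fun ::
    "('m, 'e::euclidean_space) chart set \<Rightarrow> 'm set \<Rightarrow> ('m \<Rightarrow> real) \<Rightarrow> bool" where
  "smooth_fun A U f \<longleftrightarrow> (\<forall>c\<in>A. smooth_on (snd c ` (U \<inter> fst c)) (f \<circ> chart_inv c))"

definition field_in_chart ::
    "('m, 'e::euclidean_space) chart set \<Rightarrow> ('m, 'e) chart \<Rightarrow> ('m \<Rightarrow> 'e) \<Rightarrow> 'e \<Rightarrow> 'e" where
  "field_in_chart A c X x = components A c (chart_inv c x) (X (chart_inv c x))"

definition vector_field ::
    "('m, 'e::euclidean_space) chart set \<Rightarrow> 'm set \<Rightarrow> ('m \<Rightarrow> 'e) \<Rightarrow> bool" where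
  "vector_field A U X \<longleftrightarrow> (\<forall>c\<in>A. smooth_on (snd c ` (U \<inter> fst c)) (field_in_chart A c X))"

text \<open>\<open>differential A f p v\<close> is \<open>df\<^sub>p(v)\<close>, the derivative of \<open>f\<close> along the tangent vector \<open>v\<close>.\<close>

definition differential ::
    "('m, 'e::euclidean_space) chart set \<Rightarrow> ('m \<Rightarrow> real) \<Rightarrow> 'm \<Rightarrow> 'e \<Rightarrow> real" where
  "differential A f p v =
     frechet_derivative (f \<circ> chart_inv (chart_at A p)) (at (snd (chart_at A p) p)) v"

text \<open>
  The coordinate formula \<open>[X,Y] = DY(X) - DX(Y)\<close>, evaluated at \<open>p\<close> in the chart that represents
  the tangent vectors at \<open>p\<close>.
\<close>

definition lie_bracket ::
    "('m, 'e::euclidean_space) chart set \<Rightarrow> ('m \<Rightarrow> 'e) \<Rightarrow> ('m \<Rightarrow> 'e) \<Rightarrow> 'm \<Rightarrow> 'e" where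
  "lie_bracket A X Y p =
     (let c = chart_at A p; x = snd c p in
        frechet_derivative (field_in_chart A c Y) (at x) (X p) -
        frechet_derivative (field_in_chart A c X) (at x) (Y p))"


section \<open>Tensor fields\<close>

definition one_form ::
    "('m, 'e::euclidean_space) chart set \<Rightarrow> 'm set \<Rightarrow> ('m \<Rightarrow> 'e \<Rightarrow> real) \<Rightarrow> bool" where
  "one_form A U \<omega> \<longleftrightarrow>
     (\<forall>p\<in>U. linear (\<omega> p)) \<and>
     (\<forall>c\<in>A. \<forall>v. smooth_fun A (U \<inter> fst c) (\<lambda>p. \<omega> p (coord_field A c v p)))"

definition endomorphism_field ::
    "('m, 'e::euclidean_space) chart set \<Rightarrow> 'm set \<Rightarrow> ('m \<Rightarrow> 'e \<Rightarrow> 'e) \<Rightarrow> bool" where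
  "endomorphism_field A U J \<longleftrightarrow>
     (\<forall>p\<in>U. linear (J p)) \<and>
     (\<forall>c\<in>A. \<forall>v. vector_field A (U \<inter> fst c) (\<lambda>p. J p (coord_field A c v p)))"

definition riemannian_metric ::
    "('m, 'e::euclidean_space) chart set \<Rightarrow> 'm set \<Rightarrow> ('m \<Rightarrow> 'e \<Rightarrow> 'e \<Rightarrow> real) \<Rightarrow> bool" where
  "riemannian_metric A U g \<longleftrightarrow>
     (\<forall>p\<in>U. bilinear (g p) \<and> (\<forall>u v. g p u v = g p v u) \<and> (\<forall>v. v \<noteq> 0 \<longrightarrow> 0 < g p v v)) \<and>
     (\<forall>c\<in>A. \<forall>v w. smooth_fun A (U \<inter> fst c)
        (\<lambda>p. g p (coord_field A c v p) (coord_field A c w p)))"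

text \<open>
  A 3-form as an alternating, function-linear map on vector fields; linearity in the other two
  arguments follows by skew-symmetry.
\<close>

definition three_form ::
    "('m, 'e::euclidean_space) chart set \<Rightarrow> 'm set \<Rightarrow>
     (('m \<Rightarrow> 'e) \<Rightarrow> ('m \<Rightarrow> 'e) \<Rightarrow> ('m \<Rightarrow> 'e) \<Rightarrow> 'm \<Rightarrow> real) \<Rightarrow> bool" where
  "three_form A U c \<longleftrightarrow>
     (\<forall>X Y Z. vector_field A U X \<and> vector_field A U Y \<and> vector_field A U Z \<longrightarrow>
        smooth_fun A U (c X Y Z) \<and>
        (\<forall>p\<in>U. c X Y Z p = - c Y X Z p \<and> c X Y Z p = - c X Z Y p) \<and>
        (\<forall>X'. vector_field A U X' \<longrightarrow>
           (\<forall>p\<in>U. c (\<lambda>q. X q + X' q) Y Z p = c X Y Z p + c X' Y Z p)) \<and>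
        (\<forall>f. smooth_fun A U f \<longrightarrow>
           (\<forall>p\<in>U. c (\<lambda>q. f q *\<^sub>R X q) Y Z p = f p * c X Y Z p)))"

text \<open>
  Wedge products on a single tangent space, in the determinant convention (no factorials); see
  the two lemmas.
\<close>

definition wedge_1_1 :: "('e \<Rightarrow> real) \<Rightarrow> ('e \<Rightarrow> real) \<Rightarrow> 'e \<Rightarrow> 'e \<Rightarrow> real" where
  "wedge_1_1 \<alpha> \<beta> x y = \<alpha> x * \<beta> y - \<alpha> y * \<beta> x"

definition wedge_1_2 ::
    "('e \<Rightarrow> real) \<Rightarrow> ('e \<Rightarrow> 'e \<Rightarrow> real) \<Rightarrow> 'e \<Rightarrow> 'e \<Rightarrow> 'e \<Rightarrow> real" where
  "wedge_1_2 \<alpha> \<phi> x y z = \<alpha> x * \<phi> y z + \<alpha> y * \<phi> z x + \<alpha> z * \<phi> x y"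

lemma wedge_1_1_eq_det:
  "wedge_1_1 \<alpha> \<beta> x y = det (vector [vector [\<alpha> x, \<alpha> y], vector [\<beta> x, \<beta> y]] :: real^2^2)"
  by (simp add: wedge_1_1_def det_2)

lemma wedge_1_2_wedge_1_1_eq_det:
  "wedge_1_2 \<alpha> (wedge_1_1 \<beta> \<gamma>) x y z =
     det (vector [vector [\<alpha> x, \<alpha> y, \<alpha> z], vector [\<beta> x, \<beta> y, \<beta> z],
                  vector [\<gamma> x, \<gamma> y, \<gamma> z]] :: real^3^3)"
  by (simp add: wedge_1_2_def wedge_1_1_def det_3 algebra_simps)

text \<open>
  The action \<open>(J\<omega>)(X\<^sub>1,\<dots>,X\<^sub>k) = (-1)^k \<omega>(JX\<^sub>1,\<dots>,JX\<^sub>k)\<close> for \<open>k = 1\<close>.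
\<close>

definition act_one_form ::
    "('m \<Rightarrow> 'e \<Rightarrow> 'e) \<Rightarrow> ('m \<Rightarrow> 'e \<Rightarrow> real) \<Rightarrow> 'm \<Rightarrow> 'e \<Rightarrow> real" where
  "act_one_form J \<omega> p u = - \<omega> p (J p u)"

definition fundamental_form ::
    "('m \<Rightarrow> 'e \<Rightarrow> 'e \<Rightarrow> real) \<Rightarrow> ('m \<Rightarrow> 'e \<Rightarrow> 'e) \<Rightarrow> 'm \<Rightarrow> 'e \<Rightarrow> 'e \<Rightarrow> real" where
  "fundamental_form g J p u v = g p (J p u) v"

definition metric_dual ::
    "('m, 'e::euclidean_space) chart set \<Rightarrow> ('m \<Rightarrow> 'e \<Rightarrow> 'e \<Rightarrow> real) \<Rightarrow>
     ('m \<Rightarrow> 'e \<Rightarrow> real) \<Rightarrow> ('m \<Rightarrow> 'e) \<Rightarrow> bool" where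
  "metric_dual A g \<omega> V \<longleftrightarrow> vector_field A UNIV V \<and> (\<forall>p u. g p (V p) u = \<omega> p u)"


section \<open>Linear connections\<close>

type_synonym ('m, 'e) connection = "('m \<Rightarrow> 'e) \<Rightarrow> ('m \<Rightarrow> 'e) \<Rightarrow> 'm \<Rightarrow> 'e"

text \<open>\<open>D X Y\<close> is the derivative of \<open>Y\<close> in the direction \<open>X\<close>.\<close>

definition linear_connection ::
    "('m, 'e::euclidean_space) chart set \<Rightarrow> 'm set \<Rightarrow> ('m, 'e) connection \<Rightarrow> bool" where
  "linear_connection A U D \<longleftrightarrow>
     (\<forall>X Y. vector_field A U X \<and> vector_field A U Y \<longrightarrow>
        vector_field A U (D X Y) \<and>
        (\<forall>Z. vector_field A U Z \<longrightarrow>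
           (\<forall>p\<in>U. D (\<lambda>q. X q + Z q) Y p = D X Y p + D Z Y p \<and>
                   D X (\<lambda>q. Y q + Z q) p = D X Y p + D X Z p)) \<and>
        (\<forall>f. smooth_fun A U f \<longrightarrow>
           (\<forall>p\<in>U. D (\<lambda>q. f q *\<^sub>R X q) Y p = f p *\<^sub>R D X Y p \<and>
                   D X (\<lambda>q. f q *\<^sub>R Y q) p =
                     differential A f p (X p) *\<^sub>R Y p + f p *\<^sub>R D X Y p)))"

definition torsion ::
    "('m, 'e::euclidean_space) chart set \<Rightarrow> ('m, 'e) connection \<Rightarrow>
     ('m \<Rightarrow> 'e) \<Rightarrow> ('m \<Rightarrow> 'e) \<Rightarrow> 'm \<Rightarrow> 'e" where
  "torsion A D X Y p = D X Y p - D Y X p - lie_bracket A X Y p"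

definition parallel_one_form ::
    "('m, 'e::euclidean_space) chart set \<Rightarrow> 'm set \<Rightarrow> ('m, 'e) connection \<Rightarrow>
     ('m \<Rightarrow> 'e \<Rightarrow> real) \<Rightarrow> bool" where
  "parallel_one_form A U D \<omega> \<longleftrightarrow>
     (\<forall>X Y. vector_field A U X \<and> vector_field A U Y \<longrightarrow>
        (\<forall>p\<in>U. differential A (\<lambda>q. \<omega> q (Y q)) p (X p) - \<omega> p (D X Y p) = 0))"

definition parallel_endomorphism ::
    "('m, 'e::euclidean_space) chart set \<Rightarrow> 'm set \<Rightarrow> ('m, 'e) connection \<Rightarrow>
     ('m \<Rightarrow> 'e \<Rightarrow> 'e) \<Rightarrow> bool" where
  "parallel_endomorphism A U D J \<longleftrightarrow>
     (\<forall>X Y. vector_field A U X \<and> vector_field A U Y \<longrightarrow>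
        (\<forall>p\<in>U. D X (\<lambda>q. J q (Y q)) p - J p (D X Y p) = 0))"

definition parallel_metric ::
    "('m, 'e::euclidean_space) chart set \<Rightarrow> 'm set \<Rightarrow> ('m, 'e) connection \<Rightarrow>
     ('m \<Rightarrow> 'e \<Rightarrow> 'e \<Rightarrow> real) \<Rightarrow> bool" where
  "parallel_metric A U D g \<longleftrightarrow>
     (\<forall>X Y Z. vector_field A U X \<and> vector_field A U Y \<and> vector_field A U Z \<longrightarrow>
        (\<forall>p\<in>U. differential A (\<lambda>q. g q (Y q) (Z q)) p (X p)
                  - g p (D X Y p) (Z p) - g p (Y p) (D X Z p) = 0))"

definition levi_civita ::
    "('m, 'e::euclidean_space) chart set \<Rightarrow> 'm set \<Rightarrow> ('m \<Rightarrow> 'e \<Rightarrow> 'e \<Rightarrow> real) \<Rightarrow>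
     ('m, 'e) connection \<Rightarrow> bool" where
  "levi_civita A U g D \<longleftrightarrow>
     linear_connection A U D \<and> parallel_metric A U D g \<and>
     (\<forall>X Y. vector_field A U X \<and> vector_field A U Y \<longrightarrow> (\<forall>p\<in>U. torsion A D X Y p = 0))"


section \<open>Hypercomplex, hyperkaehler and HKT geometry\<close>

text \<open>Integrability is the vanishing of the Nijenhuis tensor.\<close>

definition integrable_complex_structure ::
    "('m, 'e::euclidean_space) chart set \<Rightarrow> 'm set \<Rightarrow> ('m \<Rightarrow> 'e \<Rightarrow> 'e) \<Rightarrow> bool" where
  "integrable_complex_structure A U J \<longleftrightarrow>
     endomorphism_field A U J \<and>
     (\<forall>p\<in>U. \<forall>u. J p (J p u) = - u) \<and>
     (\<forall>X Y. vector_field A U X \<and> vector_field A U Y \<longrightarrow>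
        (\<forall>p\<in>U. lie_bracket A X Y p
                  + J p (lie_bracket A (\<lambda>q. J q (X q)) Y p)
                  + J p (lie_bracket A X (\<lambda>q. J q (Y q)) p)
                  - lie_bracket A (\<lambda>q. J q (X q)) (\<lambda>q. J q (Y q)) p = 0))"

definition hypercomplex ::
    "('m, 'e::euclidean_space) chart set \<Rightarrow> 'm set \<Rightarrow>
     ('m \<Rightarrow> 'e \<Rightarrow> 'e) \<Rightarrow> ('m \<Rightarrow> 'e \<Rightarrow> 'e) \<Rightarrow> ('m \<Rightarrow> 'e \<Rightarrow> 'e) \<Rightarrow> bool" where
  "hypercomplex A U I1 I2 I3 \<longleftrightarrow>
     (\<forall>J\<in>{I1, I2, I3}. integrable_complex_structure A U J) \<and>
     (\<forall>p\<in>U. \<forall>u. I1 p (I2 p u) = I3 p u \<and> I2 p (I1 p u) = - I3 p u)"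

definition hyperhermitian ::
    "('m, 'e::euclidean_space) chart set \<Rightarrow> 'm set \<Rightarrow> ('m \<Rightarrow> 'e \<Rightarrow> 'e \<Rightarrow> real) \<Rightarrow>
     ('m \<Rightarrow> 'e \<Rightarrow> 'e) \<Rightarrow> ('m \<Rightarrow> 'e \<Rightarrow> 'e) \<Rightarrow> ('m \<Rightarrow> 'e \<Rightarrow> 'e) \<Rightarrow> bool" where
  "hyperhermitian A U g I1 I2 I3 \<longleftrightarrow>
     hypercomplex A U I1 I2 I3 \<and> riemannian_metric A U g \<and>
     (\<forall>J\<in>{I1, I2, I3}. \<forall>p\<in>U. \<forall>u v. g p (J p u) (J p v) = g p u v)"

text \<open>
  The Levi-Civita connection is unique (on smooth fields over \<open>U\<close>), so the existential quantifier
  merely names it.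
\<close>

definition hyperkaehler ::
    "('m, 'e::euclidean_space) chart set \<Rightarrow> 'm set \<Rightarrow> ('m \<Rightarrow> 'e \<Rightarrow> 'e \<Rightarrow> real) \<Rightarrow>
     ('m \<Rightarrow> 'e \<Rightarrow> 'e) \<Rightarrow> ('m \<Rightarrow> 'e \<Rightarrow> 'e) \<Rightarrow> ('m \<Rightarrow> 'e \<Rightarrow> 'e) \<Rightarrow> bool" where
  "hyperkaehler A U g I1 I2 I3 \<longleftrightarrow>
     hyperhermitian A U g I1 I2 I3 \<and>
     (\<exists>D. levi_civita A U g D \<and> (\<forall>J\<in>{I1, I2, I3}. parallel_endomorphism A U D J))"

text \<open>
  A family of triples \<open>(U\<^sub>i, f\<^sub>i, g\<^sub>i)\<close> with \<open>g = exp(f\<^sub>i) g\<^sub>i\<close> on \<open>U\<^sub>i\<close> and \<open>g\<^sub>i\<close>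
  hyperkaehler.
\<close>

definition hyperkaehler_cover ::
    "('m::topological_space, 'e::euclidean_space) chart set \<Rightarrow> ('m \<Rightarrow> 'e \<Rightarrow> 'e \<Rightarrow> real) \<Rightarrow>
     ('m \<Rightarrow> 'e \<Rightarrow> 'e) \<Rightarrow> ('m \<Rightarrow> 'e \<Rightarrow> 'e) \<Rightarrow> ('m \<Rightarrow> 'e \<Rightarrow> 'e) \<Rightarrow>
     ('m set \<times> ('m \<Rightarrow> real) \<times> ('m \<Rightarrow> 'e \<Rightarrow> 'e \<Rightarrow> real)) set \<Rightarrow> bool" where
  "hyperkaehler_cover A g I1 I2 I3 C \<longleftrightarrow>
     (\<Union>(U, f, h)\<in>C. U) = UNIV \<and>
     (\<forall>(U, f, h)\<in>C. open U \<and> smooth_fun A U f \<and> hyperkaehler A U h I1 I2 I3 \<and>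
        (\<forall>p\<in>U. \<forall>u v. g p u v = exp (f p) * h p u v))"

definition locally_conformally_hyperkaehler ::
    "('m::topological_space, 'e::euclidean_space) chart set \<Rightarrow> ('m \<Rightarrow> 'e \<Rightarrow> 'e \<Rightarrow> real) \<Rightarrow>
     ('m \<Rightarrow> 'e \<Rightarrow> 'e) \<Rightarrow> ('m \<Rightarrow> 'e \<Rightarrow> 'e) \<Rightarrow> ('m \<Rightarrow> 'e \<Rightarrow> 'e) \<Rightarrow> bool" where
  "locally_conformally_hyperkaehler A g I1 I2 I3 \<longleftrightarrow>
     hyperhermitian A UNIV g I1 I2 I3 \<and> (\<exists>C. hyperkaehler_cover A g I1 I2 I3 C)"

text \<open>
  The 1-form does not depend on the cover: \<open>dF\<^sub>r = \<theta> \<and> F\<^sub>r\<close> determines it. It is closed because it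
  is locally exact.
\<close>

definition lee_form ::
    "('m::topological_space, 'e::euclidean_space) chart set \<Rightarrow> ('m \<Rightarrow> 'e \<Rightarrow> 'e \<Rightarrow> real) \<Rightarrow>
     ('m \<Rightarrow> 'e \<Rightarrow> 'e) \<Rightarrow> ('m \<Rightarrow> 'e \<Rightarrow> 'e) \<Rightarrow> ('m \<Rightarrow> 'e \<Rightarrow> 'e) \<Rightarrow>
     ('m \<Rightarrow> 'e \<Rightarrow> real) \<Rightarrow> bool" where
  "lee_form A g I1 I2 I3 \<theta> \<longleftrightarrow>
     one_form A UNIV \<theta> \<and>
     (\<exists>C. hyperkaehler_cover A g I1 I2 I3 C \<and>
        (\<forall>(U, f, h)\<in>C. \<forall>p\<in>U. \<forall>u. \<theta> p u = differential A f p u))"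

definition torsion_form ::
    "('m, 'e::euclidean_space) chart set \<Rightarrow> ('m \<Rightarrow> 'e \<Rightarrow> 'e \<Rightarrow> real) \<Rightarrow> ('m, 'e) connection \<Rightarrow>
     ('m \<Rightarrow> 'e) \<Rightarrow> ('m \<Rightarrow> 'e) \<Rightarrow> ('m \<Rightarrow> 'e) \<Rightarrow> 'm \<Rightarrow> real" where
  "torsion_form A g D X Y Z p = g p (torsion A D X Y p) (Z p)"

definition HKT_connection ::
    "('m, 'e::euclidean_space) chart set \<Rightarrow> ('m \<Rightarrow> 'e \<Rightarrow> 'e \<Rightarrow> real) \<Rightarrow>
     ('m \<Rightarrow> 'e \<Rightarrow> 'e) \<Rightarrow> ('m \<Rightarrow> 'e \<Rightarrow> 'e) \<Rightarrow> ('m \<Rightarrow> 'e \<Rightarrow> 'e) \<Rightarrow>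
     ('m, 'e) connection \<Rightarrow> bool" where
  "HKT_connection A g I1 I2 I3 D \<longleftrightarrow>
     hyperhermitian A UNIV g I1 I2 I3 \<and> linear_connection A UNIV D \<and>
     parallel_metric A UNIV D g \<and>
     (\<forall>J\<in>{I1, I2, I3}. parallel_endomorphism A UNIV D J) \<and>
     three_form A UNIV (torsion_form A g D)"

end

theory Submission
  imports Defs
begin

text \<open>
  Near each point \<open>g = exp f \<cdot> h\<close> with \<open>h\<close> hyperkaehler; let \<open>N\<close> be the Levi-Civita connection
  of \<open>h\<close>, which is torsion-free and preserves every \<open>I\<^sub>r\<close>. Comparing it with the Levi-Civita
  connection of \<open>g\<close> turns the hypothesis that \<open>\<theta>\<close> is parallel into
  \<open>(N\<^sub>X \<theta>) Y = \<theta> X \<theta> Y - g(X, Y) / 2\<close>, so the covariant derivative \<open>Q\<close> of the metric \<open>ghat\<close> with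
  respect to \<open>N\<close> is an explicit algebraic expression in \<open>g\<close>, \<open>\<theta>\<close> and the \<open>I\<^sub>r\<close>. The difference \<open>D - N\<close> commutes
  with \<open>I\<^sub>1\<close>, fails to be \<open>ghat\<close>-skew by exactly \<open>Q\<close>, and its skew-symmetrisation is the torsion \<open>c\<close>.
  Since \<open>c\<close> is totally skew, the Koszul formula and the type condition
  \<open>c(X, Y, Z) = c(I\<^sub>1X, I\<^sub>1Y, Z) + c(I\<^sub>1X, Y, I\<^sub>1Z) + c(X, I\<^sub>1Y, I\<^sub>1Z)\<close> express \<open>c\<close> through \<open>Q\<close> alone, and
  the formula becomes an identity of quaternionic linear algebra.
\<close>

section \<open>Calculus of smooth maps\<close>

text \<open>Openness of \<open>S\<close> makes \<open>f\<close> and \<open>g\<close> agree near each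
  of its points, so their two-sided derivatives agree too and the induction can pass to
  them.\<close>

lemma times_differentiable_on_cong:
  assumes "open S" "\<And>x. x \<in> S \<Longrightarrow> f x = g x" "times_differentiable_on k S f"
  shows "times_differentiable_on k S g"
  using assms(2,3)
proof (induction k arbitrary: f g)
  case 0
  then show ?case
    using continuous_on_cong[of S S f g] by simp
next
  case (Suc k)
  have *: "(g has_derivative frechet_derivative f (at x)) (at x)" if "x \<in> S" for x
  proof (rule has_derivative_transform_within_open[OF _ assms(1) that])
    show "(f has_derivative frechet_derivative f (at x)) (at x)"
      using Suc.prems(2) that by (simp add: frechet_derivative_works[symmetric])
  qed (rule Suc.prems(1))
  have "times_differentiable_on k S (\<lambda>x. frechet_derivative g (at x) v)" for v
  proof (rule Suc.IH)
    show "frechet_derivative f (at x) v = frechet_derivative g (at x) v" if "x \<in> S" for x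
      using frechet_derivative_at[OF *[OF that]] by (rule fun_cong)
    show "times_differentiable_on k S (\<lambda>x. frechet_derivative f (at x) v)"
      using Suc.prems(2) by simp
  qed
  then show ?case
    using * by (auto intro: differentiableI)
qed

lemma times_differentiable_on_frechet_derivative:
  "times_differentiable_on (Suc k) S f \<Longrightarrow>
    times_differentiable_on k S (\<lambda>x. frechet_derivative f (at x) v)"
  by simp

lemma times_differentiable_on_SucD:
  "times_differentiable_on (Suc k) S f \<Longrightarrow> times_differentiable_on k S f"
proof (induction k arbitrary: f)
  case 0
  then show ?case
    by (simp add: continuous_at_imp_continuous_on differentiable_imp_continuous_within)
next
  case (Suc k)
  note Suc.IH[OF times_differentiable_on_frechet_derivative[OF Suc.prems]]
  then show ?case
    using Suc.prems by simp
qed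

text \<open>Lets an explicit derivative \<open>F\<close> stand in for
  \<open>frechet_derivative\<close>, so that each closure property follows by induction from the
  matching \<open>has_derivative\<close> rule.\<close>

lemma times_differentiable_on_SucI:
  assumes "open S" and F: "\<And>x. x \<in> S \<Longrightarrow> (f has_derivative F x) (at x)"
    and "\<And>v. times_differentiable_on k S (\<lambda>x. F x v)"
  shows "times_differentiable_on (Suc k) S f"
proof -
  have "times_differentiable_on k S (\<lambda>x. frechet_derivative f (at x) v)" for v
  proof (rule times_differentiable_on_cong[OF assms(1) _ assms(3)])
    show "F x v = frechet_derivative f (at x) v" if "x \<in> S" for x
      using frechet_derivative_at[OF F[OF that]] by (rule fun_cong)
  qed
  then show ?thesis
    using F by (auto intro: differentiableI)
qed

lemma times_differentiable_on_Suc_has_derivative: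
  assumes "times_differentiable_on (Suc k) S f" "x \<in> S"
  shows "(f has_derivative frechet_derivative f (at x)) (at x)"
  using assms by (simp add: frechet_derivative_works[symmetric])

lemma times_differentiable_on_const: "open S \<Longrightarrow> times_differentiable_on k S (\<lambda>x. a)"
proof (induction k arbitrary: a)
  case (Suc k)
  show ?case
    by (rule times_differentiable_on_SucI[OF \<open>open S\<close> has_derivative_const Suc.IH[OF \<open>open S\<close>]])
qed simp

lemma times_differentiable_on_add:
  assumes "open S" "times_differentiable_on k S f" "times_differentiable_on k S g"
  shows "times_differentiable_on k S (\<lambda>x. f x + g x)"
  using assms(2,3)
proof (induction k arbitrary: f g)
  case 0
  then show ?case by (simp add: continuous_on_add)
next
  case (Suc k)
  note d = Suc.prems[THEN times_differentiable_on_Suc_has_derivative]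
  note d' = Suc.prems[THEN times_differentiable_on_frechet_derivative]
  show ?case
    by (rule times_differentiable_on_SucI[OF assms(1) has_derivative_add[OF d] Suc.IH[OF d']])
qed

lemma times_differentiable_on_bounded_linear:
  assumes "open S" "bounded_linear L" "times_differentiable_on k S f"
  shows "times_differentiable_on k S (\<lambda>x. L (f x))"
  using assms(3)
proof (induction k arbitrary: f)
  case 0
  then show ?case
    using bounded_linear.continuous_on[OF assms(2)] by simp
next
  case (Suc k)
  note d = Suc.prems[THEN times_differentiable_on_Suc_has_derivative]
  note d' = Suc.prems[THEN times_differentiable_on_frechet_derivative]
  show ?case
    by (rule times_differentiable_on_SucI[OF assms(1)
          bounded_linear.has_derivative[OF assms(2) d] Suc.IH[OF d']])
qed

lemma times_differentiable_on_scaleR: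
  fixes f :: "_ \<Rightarrow> real"
  assumes "open S" "times_differentiable_on k S f" "times_differentiable_on k S g"
  shows "times_differentiable_on k S (\<lambda>x. f x *\<^sub>R g x)"
  using assms(2,3)
proof (induction k arbitrary: f g)
  case 0
  then show ?case by (simp add: continuous_on_scaleR)
next
  case (Suc k)
  note d = Suc.prems[THEN times_differentiable_on_Suc_has_derivative]
  note d' = Suc.prems[THEN times_differentiable_on_frechet_derivative]
  \<comment> \<open>The product rule leaves one factor undifferentiated; that factor must be lowered
    to order \<open>k\<close> for the induction hypothesis.\<close>
  note d0 = Suc.prems[THEN times_differentiable_on_SucD]
  show ?case
    by (rule times_differentiable_on_SucI[OF assms(1) has_derivative_scaleR[OF d]
          times_differentiable_on_add[OF assms(1) Suc.IH[OF d0(1) d'(2)] Suc.IH[OF d'(1) d0(2)]]])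
qed

lemma times_differentiable_on_subset:
  "T \<subseteq> S \<Longrightarrow> times_differentiable_on k S f \<Longrightarrow> times_differentiable_on k T f"
  by (induction k arbitrary: f) (simp_all add: continuous_on_subset subset_iff)

lemma smooth_on_cong: "open S \<Longrightarrow> (\<And>x. x \<in> S \<Longrightarrow> f x = g x) \<Longrightarrow> smooth_on S f \<Longrightarrow> smooth_on S g"
  unfolding smooth_on_def using times_differentiable_on_cong[of S f g] by blast

lemma smooth_on_subset: "smooth_on S f \<Longrightarrow> T \<subseteq> S \<Longrightarrow> smooth_on T f"
  unfolding smooth_on_def using times_differentiable_on_subset[of T S _ f] by blast

lemma smooth_on_bounded_linear:
  "open S \<Longrightarrow> bounded_linear L \<Longrightarrow> smooth_on S f \<Longrightarrow> smooth_on S (\<lambda>x. L (f x))"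
  unfolding smooth_on_def using times_differentiable_on_bounded_linear[of S L _ f] by blast

lemma smooth_on_scaleR:
  fixes f :: "_ \<Rightarrow> real"
  shows "open S \<Longrightarrow> smooth_on S f \<Longrightarrow> smooth_on S g \<Longrightarrow> smooth_on S (\<lambda>x. f x *\<^sub>R g x)"
  unfolding smooth_on_def using times_differentiable_on_scaleR[of S _ f g] by blast

lemma smooth_on_sum:
  assumes "open S" "\<And>i. i \<in> I \<Longrightarrow> smooth_on S (f i)"
  shows "smooth_on S (\<lambda>x. \<Sum>i\<in>I. f i x)"
  using assms(2)
proof (induction I rule: infinite_finite_induct)
  case (insert i I)
  then show ?case
    using assms(1) by (simp add: smooth_on_def times_differentiable_on_add)
qed (simp_all add: smooth_on_def times_differentiable_on_const assms(1))

lemma smooth_on_imp_differentiable: "smooth_on S f \<Longrightarrow> x \<in> S \<Longrightarrow> f differentiable at x"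
  unfolding smooth_on_def using times_differentiable_on.simps(2)[of 0 S f] by blast


section \<open>Charts, fields and differentials\<close>

locale smooth_atlas =
  fixes A :: "('m::{t2_space, second_countable_topology}, 'e::euclidean_space) chart set"
  assumes atlas: "smooth_manifold A"
begin

lemma chart_homeomorphism:
  "c \<in> A \<Longrightarrow> homeomorphism (fst c) (snd c ` fst c) (snd c) (chart_inv c)"
  using atlas unfolding smooth_manifold_def by blast

lemma chart_inv_chart: "c \<in> A \<Longrightarrow> p \<in> fst c \<Longrightarrow> chart_inv c (snd c p) = p"
  using homeomorphism_apply1[OF chart_homeomorphism] by blast

lemma open_chart_image:
  assumes "c \<in> A" "open U"
  shows "open (snd c ` (U \<inter> fst c))"
proof -
  have *: "open (fst c)" "open (snd c ` fst c)"
    using atlas assms(1) unfolding smooth_manifold_def by blast+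
  have "openin (top_of_set (snd c ` fst c)) (snd c ` (U \<inter> fst c))"
    using assms by (intro homeomorphism_imp_open_map[OF chart_homeomorphism])
      (auto intro: openin_open_Int simp: Int_commute[of U])
  then show ?thesis
    using * openin_open_eq by blast
qed

lemma chart_at: "chart_at A p \<in> A" "p \<in> fst (chart_at A p)"
proof -
  have "\<exists>c. c \<in> A \<and> p \<in> fst c"
    using atlas unfolding smooth_manifold_def by blast
  from someI_ex[OF this] show "chart_at A p \<in> A" "p \<in> fst (chart_at A p)"
    unfolding chart_at_def by blast+
qed

section \<open>Change of charts on tangent spaces\<close>

lemma transition_has_derivative:
  assumes "c \<in> A" "d \<in> A" "p \<in> fst c" "p \<in> fst d"
  shows "(transition c d has_derivative tangent_change c d p) (at (snd c p))"
proof -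
  have "smooth_on (snd c ` (fst c \<inter> fst d)) (transition c d)"
    using atlas assms unfolding smooth_manifold_def by blast
  then have "transition c d differentiable at (snd c p)"
    using assms by (intro smooth_on_imp_differentiable) auto
  then show ?thesis
    unfolding tangent_change_def by (simp add: frechet_derivative_works[symmetric])
qed

lemma bounded_linear_tangent_change:
  assumes "c \<in> A" "d \<in> A" "p \<in> fst c" "p \<in> fst d"
  shows "bounded_linear (tangent_change c d p)"
  using transition_has_derivative[OF assms] by (rule has_derivative_bounded_linear)

text \<open>The chain rule; the transition maps compose as required only over the common domain of
  \<open>c\<close> and \<open>d\<close>, which is an open neighbourhood of the point.\<close>

lemma tangent_change_tangent_change:
  assumes "c \<in> A" "d \<in> A" "e \<in> A" "p \<in> fst c" "p \<in> fst d" "p \<in> fst e"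
  shows "tangent_change d e p (tangent_change c d p v) = tangent_change c e p v"
proof -
  have cd: "transition c d (snd c p) = snd d p"
    using assms by (simp add: transition_def chart_inv_chart)
  have "(transition d e \<circ> transition c d has_derivative
      tangent_change d e p \<circ> tangent_change c d p) (at (snd c p))"
    using assms transition_has_derivative[of d e p]
    by (intro diff_chain_at transition_has_derivative) (simp_all add: cd)
  then have "(transition c e has_derivative tangent_change d e p \<circ> tangent_change c d p) (at (snd c p))"
  proof (rule has_derivative_transform_within_open)
    have "open (fst d)"
      using atlas assms(2) unfolding smooth_manifold_def by blast
    then show "open (snd c ` (fst d \<inter> fst c))"
      by (rule open_chart_image[OF assms(1)])
    show "snd c p \<in> snd c ` (fst d \<inter> fst c)"
      using assms by blast
    show "(transition d e \<circ> transition c d) x = transition c e x"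
      if "x \<in> snd c ` (fst d \<inter> fst c)" for x
      using that assms by (auto simp: transition_def chart_inv_chart)
  qed
  from has_derivative_unique[OF this transition_has_derivative[of c e p]] assms
  show ?thesis
    by (metis comp_apply)
qed

lemma tangent_change_self:
  assumes "c \<in> A" "p \<in> fst c"
  shows "tangent_change c c p v = v"
proof -
  have "((\<lambda>x. x) has_derivative tangent_change c c p) (at (snd c p))"
  proof (rule has_derivative_transform_within_open[OF transition_has_derivative])
    show "open (snd c ` (UNIV \<inter> fst c))"
      by (rule open_chart_image[OF assms(1)]) simp
    show "transition c c x = x" if "x \<in> snd c ` (UNIV \<inter> fst c)" for x
      using that assms by (auto simp: transition_def chart_inv_chart)
  qed (use assms in auto)
  from has_derivative_unique[OF this has_derivative_ident] show ?thesis
    by simp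
qed

lemma coord_field_components:
  assumes "c \<in> A" "p \<in> fst c"
  shows "coord_field A c (components A c p v) p = v"
  using assms chart_at[of p]
  by (simp add: coord_field_def components_def tangent_change_tangent_change tangent_change_self)

text \<open>Smoothness of tensor fields is postulated only on coordinate fields; expanding in this
  frame carries it over to arbitrary vector fields.\<close>

lemma coord_field_expansion:
  assumes "c \<in> A" "p \<in> fst c"
  shows "(\<Sum>b\<in>Basis. (components A c p v \<bullet> b) *\<^sub>R coord_field A c b p) = v"
proof -
  interpret bounded_linear "tangent_change c (chart_at A p) p"
    using assms chart_at by (intro bounded_linear_tangent_change)
  have "coord_field A c (\<Sum>b\<in>Basis. (components A c p v \<bullet> b) *\<^sub>R b) p = v"
    using coord_field_components[OF assms] by (simp only: euclidean_representation)
  then show ?thesis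
    by (simp add: coord_field_def sum scaleR)
qed

lemma field_in_chart_chart: "c \<in> A \<Longrightarrow> p \<in> fst c \<Longrightarrow>
    field_in_chart A c X (snd c p) = components A c p (X p)"
  by (simp add: field_in_chart_def chart_inv_chart)

section \<open>Tensor fields evaluated on smooth vector fields\<close>

lemma smooth_on_field_coefficient:
  assumes "vector_field A U X" "open U" "c \<in> A"
  shows "smooth_on (snd c ` (U \<inter> fst c)) (\<lambda>x. field_in_chart A c X x \<bullet> b)"
  using assms unfolding vector_field_def
  by (intro smooth_on_bounded_linear[OF open_chart_image bounded_linear_inner_left]) auto

lemma vector_field_subset: "vector_field A U X \<Longrightarrow> W \<subseteq> U \<Longrightarrow> vector_field A W X"
  unfolding vector_field_def by (meson Int_mono image_mono order_refl smooth_on_subset)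

text \<open>By linearity of \<open>J p\<close>, the result is a sum of smooth coefficients of
  \<open>X\<close> times the smooth images of coordinate fields. The same expansion serves 1-forms
  and metrics below.\<close>

lemma vector_field_endomorphism:
  assumes J: "endomorphism_field A U J" and X: "vector_field A U X" and U: "open U"
  shows "vector_field A U (\<lambda>p. J p (X p))"
  unfolding vector_field_def
proof
  fix c assume c: "c \<in> A"
  let ?S = "snd c ` (U \<inter> fst c)"
  let ?E = "\<lambda>b. field_in_chart A c (\<lambda>p. J p (coord_field A c b p))"
  have S: "open ?S"
    using open_chart_image[OF c U] .
  show "smooth_on ?S (field_in_chart A c (\<lambda>p. J p (X p)))"
  proof (rule smooth_on_cong[OF S])
    have "smooth_on ?S (?E b)" for b
      using J c unfolding endomorphism_field_def vector_field_def by (metis Int_assoc Int_absorb)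
    then show "smooth_on ?S (\<lambda>x. \<Sum>b\<in>Basis. (field_in_chart A c X x \<bullet> b) *\<^sub>R ?E b x)"
      by (intro smooth_on_sum smooth_on_scaleR smooth_on_field_coefficient[OF X U c] S)
    fix x assume "x \<in> ?S"
    then obtain p where p: "p \<in> U" "p \<in> fst c" and x: "x = snd c p"
      by blast
    interpret J: linear "J p"
      using J p unfolding endomorphism_field_def by blast
    interpret comp: bounded_linear "components A c p"
      unfolding components_def using chart_at c p by (intro bounded_linear_tangent_change) auto
    have "components A c p (J p (X p)) =
        components A c p (J p (\<Sum>b\<in>Basis. (components A c p (X p) \<bullet> b) *\<^sub>R coord_field A c b p))"
      using coord_field_expansion[OF c p(2)] by simp
    then show "(\<Sum>b\<in>Basis. (field_in_chart A c X x \<bullet> b) *\<^sub>R ?E b x) =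
        field_in_chart A c (\<lambda>p. J p (X p)) x"
      by (simp add: x field_in_chart_chart[OF c p(2)] J.sum J.scale comp.sum comp.scaleR)
  qed
qed

lemma smooth_fun_one_form:
  assumes \<omega>: "one_form A U \<omega>" and X: "vector_field A U X" and U: "open U"
  shows "smooth_fun A U (\<lambda>p. \<omega> p (X p))"
  unfolding smooth_fun_def
proof
  fix c assume c: "c \<in> A"
  let ?S = "snd c ` (U \<inter> fst c)"
  let ?E = "\<lambda>b. (\<lambda>p. \<omega> p (coord_field A c b p)) \<circ> chart_inv c"
  have S: "open ?S"
    using open_chart_image[OF c U] .
  show "smooth_on ?S ((\<lambda>p. \<omega> p (X p)) \<circ> chart_inv c)"
  proof (rule smooth_on_cong[OF S])
    have "smooth_on ?S (?E b)" for b
      using \<omega> c unfolding one_form_def smooth_fun_def by (metis Int_assoc Int_absorb)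
    then show "smooth_on ?S (\<lambda>x. \<Sum>b\<in>Basis. (field_in_chart A c X x \<bullet> b) *\<^sub>R ?E b x)"
      by (intro smooth_on_sum smooth_on_scaleR smooth_on_field_coefficient[OF X U c] S)
    fix x assume "x \<in> ?S"
    then obtain p where p: "p \<in> U" "p \<in> fst c" and x: "x = snd c p"
      by blast
    interpret linear "\<omega> p"
      using \<omega> p unfolding one_form_def by blast
    have "\<omega> p (X p) = \<omega> p (\<Sum>b\<in>Basis. (components A c p (X p) \<bullet> b) *\<^sub>R coord_field A c b p)"
      using coord_field_expansion[OF c p(2)] by simp
    then show "(\<Sum>b\<in>Basis. (field_in_chart A c X x \<bullet> b) *\<^sub>R ?E b x) =
        ((\<lambda>p. \<omega> p (X p)) \<circ> chart_inv c) x"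
      by (simp add: x field_in_chart_chart[OF c p(2)] chart_inv_chart[OF c p(2)] sum scale)
  qed
qed

lemma smooth_fun_metric:
  assumes g: "riemannian_metric A U g" and X: "vector_field A U X" and Y: "vector_field A U Y"
    and U: "open U"
  shows "smooth_fun A U (\<lambda>p. g p (X p) (Y p))"
  unfolding smooth_fun_def
proof
  fix c assume c: "c \<in> A"
  let ?S = "snd c ` (U \<inter> fst c)"
  let ?E = "\<lambda>a b. (\<lambda>p. g p (coord_field A c a p) (coord_field A c b p)) \<circ> chart_inv c"
  have S: "open ?S"
    using open_chart_image[OF c U] .
  show "smooth_on ?S ((\<lambda>p. g p (X p) (Y p)) \<circ> chart_inv c)"
  proof (rule smooth_on_cong[OF S])
    have "smooth_on ?S (?E a b)" for a b
      using g c unfolding riemannian_metric_def smooth_fun_def by (metis Int_assoc Int_absorb)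
    then show "smooth_on ?S (\<lambda>x. \<Sum>a\<in>Basis. \<Sum>b\<in>Basis. (field_in_chart A c X x \<bullet> a) *\<^sub>R
        (field_in_chart A c Y x \<bullet> b) *\<^sub>R ?E a b x)"
      by (intro smooth_on_sum smooth_on_scaleR smooth_on_field_coefficient[OF X U c]
          smooth_on_field_coefficient[OF Y U c] S)
    fix x assume "x \<in> ?S"
    then obtain p where p: "p \<in> U" "p \<in> fst c" and x: "x = snd c p"
      by blast
    have g: "bilinear (g p)"
      using g p unfolding riemannian_metric_def by blast
    have "g p (X p) (Y p) = g p (\<Sum>a\<in>Basis. (components A c p (X p) \<bullet> a) *\<^sub>R coord_field A c a p)
        (\<Sum>b\<in>Basis. (components A c p (Y p) \<bullet> b) *\<^sub>R coord_field A c b p)"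
      using coord_field_expansion[OF c p(2)] by simp
    then show "(\<Sum>a\<in>Basis. \<Sum>b\<in>Basis. (field_in_chart A c X x \<bullet> a) *\<^sub>R
        (field_in_chart A c Y x \<bullet> b) *\<^sub>R ?E a b x) = ((\<lambda>p. g p (X p) (Y p)) \<circ> chart_inv c) x"
      by (simp add: x field_in_chart_chart[OF c p(2)] chart_inv_chart[OF c p(2)]
          bilinear_sum[OF g] sum.cartesian_product bilinear_lmul[OF g] bilinear_rmul[OF g]
          mult.left_commute)
  qed
qed

section \<open>Differentials computed in the chart at a point\<close>

lemma differential_has_derivative:
  assumes "smooth_fun A U f" "p \<in> U"
  shows "(f \<circ> chart_inv (chart_at A p) has_derivative differential A f p)
    (at (snd (chart_at A p) p))"
proof -
  have "f \<circ> chart_inv (chart_at A p) differentiable at (snd (chart_at A p) p)"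
    using assms chart_at[of p] unfolding smooth_fun_def
    by (intro smooth_on_imp_differentiable[of "snd (chart_at A p) ` (U \<inter> fst (chart_at A p))"]) auto
  then show ?thesis
    by (simp add: frechet_derivative_works differential_def[abs_def])
qed

text \<open>A differential depends only on values near \<open>p\<close>, so a relation that holds on
  \<open>U\<close> alone, such as the conformal one between the two metrics, may be
  differentiated.\<close>

lemma differential_eqI:
  assumes "(f \<circ> chart_inv (chart_at A p) has_derivative F) (at (snd (chart_at A p) p))"
    and "open U" "p \<in> U" "\<And>q. q \<in> U \<Longrightarrow> f q = f' q"
  shows "differential A f' p v = F v"
proof -
  let ?c = "chart_at A p"
  have "(f' \<circ> chart_inv ?c has_derivative F) (at (snd ?c p))"
  proof (rule has_derivative_transform_within_open[OF assms(1)])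
    show "open (snd ?c ` (U \<inter> fst ?c))"
      using chart_at(1) assms(2) by (rule open_chart_image)
    show "snd ?c p \<in> snd ?c ` (U \<inter> fst ?c)"
      using chart_at(2) assms(3) by blast
    show "(f \<circ> chart_inv ?c) x = (f' \<circ> chart_inv ?c) x" if "x \<in> snd ?c ` (U \<inter> fst ?c)" for x
      using that assms(4) by (auto simp: chart_inv_chart[OF chart_at(1)])
  qed
  from frechet_derivative_at[OF this] show ?thesis
    by (simp add: differential_def)
qed

end


section \<open>Linear algebra of the torsion\<close>

text \<open>
  \<open>J\<close> acts on a set \<open>S\<close> without linear structure because the lemma is applied to vector
  fields: no tensoriality of \<open>B\<close> has to be established.
\<close>

lemma hermitian_torsion_formula:
  fixes B Q :: "'a \<Rightarrow> 'a \<Rightarrow> 'a \<Rightarrow> real" and J :: "'a \<Rightarrow> 'a" and S :: "'a set"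
  defines "c \<equiv> \<lambda>X Y Z. B X Y Z - B Y X Z"
    and "K \<equiv> \<lambda>X Y Z. Q X Y Z + Q Y X Z - Q Z X Y"
  assumes J: "\<And>X. X \<in> S \<Longrightarrow> J X \<in> S"
    and metric: "\<And>X Y Z. X \<in> S \<Longrightarrow> Y \<in> S \<Longrightarrow> Z \<in> S \<Longrightarrow> B X Y Z + B X Z Y = Q X Y Z"
    and skew: "\<And>X Y Z. X \<in> S \<Longrightarrow> Y \<in> S \<Longrightarrow> Z \<in> S \<Longrightarrow> B X (J Y) Z = - B X Y (J Z)"
    and invariant: "\<And>X Y Z. X \<in> S \<Longrightarrow> Y \<in> S \<Longrightarrow> Z \<in> S \<Longrightarrow> B X (J Y) (J Z) = B X Y Z"
    and alternating: "\<And>X Y Z. X \<in> S \<Longrightarrow> Y \<in> S \<Longrightarrow> Z \<in> S \<Longrightarrow> c X Y Z = - c X Z Y"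
    and S: "X \<in> S" "Y \<in> S" "Z \<in> S"
  shows "2 * c X Y Z = - (K (J X) (J Y) Z + K (J X) Y (J Z)
    + K (J Y) (J Z) X + K (J Y) Z (J X) + K (J Z) (J X) Y + K (J Z) X (J Y))"
proof -
  \<comment> \<open>Add the metric relations for \<open>X\<close> and \<open>Y\<close> and subtract
    the one for \<open>Z\<close>; total skewness merges the three torsion terms into one.\<close>
  have koszul: "2 * B X Y Z = K X Y Z + c X Y Z" if "X \<in> S" "Y \<in> S" "Z \<in> S" for X Y Z
    using metric[of X Y Z] metric[of Y X Z] metric[of Z X Y] that
      alternating[of X Z Y] alternating[of Y X Z] alternating[of X Y Z] alternating[of Z X Y]
    unfolding c_def K_def by linarith
  \<comment> \<open>By \<open>skew\<close> the two \<open>B\<close> terms of the Koszul formulas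
    cancel, which leaves only torsion.\<close>
  have K: "K (J X) (J Y) Z + K (J X) Y (J Z) = - c (J X) (J Y) Z - c (J X) Y (J Z)"
    if "X \<in> S" "Y \<in> S" "Z \<in> S" for X Y Z
    using koszul[of "J X" "J Y" Z] koszul[of "J X" Y "J Z"] skew[of "J X" Y Z] that J by simp
  \<comment> \<open>The torsion has no (3,0) or (0,3) part: \<open>skew\<close> cancels the terms
    whose first argument carries \<open>J\<close>, and \<open>invariant\<close> restores the
    others.\<close>
  have type: "c X Y Z = c (J X) (J Y) Z + c (J X) Y (J Z) + c X (J Y) (J Z)"
    unfolding c_def
    using S J skew[of "J X" Y Z] skew[of "J Y" X Z] invariant[of X Y Z] invariant[of Y X Z] by simp
  have cyc: "c X Y Z = c Y Z X" "c X Y Z = c Z X Y" if "X \<in> S" "Y \<in> S" "Z \<in> S" for X Y Z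
    using that alternating[of X Y Z] alternating[of Y X Z] alternating[of X Z Y] alternating[of Z X Y]
    by (auto simp: c_def)
  \<comment> \<open>In the cyclic sum of \<open>K\<close>, each of the three terms of
    \<open>type\<close> occurs twice, up to a cyclic permutation of its arguments.\<close>
  show ?thesis
    using K[OF S] K[OF S(2,3,1)] K[OF S(3,1,2)] type cyc[OF J[OF S(1)] J[OF S(2)] S(3)]
      cyc[OF J[OF S(1)] S(2) J[OF S(3)]] cyc[OF S(1) J[OF S(2)] J[OF S(3)]] by linarith
qed

text \<open>The metric \<open>ghat\<close> on a single tangent space. The signs of
  \<open>act_one_form\<close> cancel in the products, so \<open>\<theta> (I x)\<close> appears
  without a minus.\<close>

definition reduced_metric :: "('v \<Rightarrow> 'v \<Rightarrow> real) \<Rightarrow> ('v \<Rightarrow> real) \<Rightarrow>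
    ('v \<Rightarrow> 'v) \<Rightarrow> ('v \<Rightarrow> 'v) \<Rightarrow> ('v \<Rightarrow> 'v) \<Rightarrow> 'v \<Rightarrow> 'v \<Rightarrow> real" where
  "reduced_metric g \<theta> I J K x y = g x y - 1/2 * (\<theta> x * \<theta> y + \<theta> (I x) * \<theta> (I y)
     + \<theta> (J x) * \<theta> (J y) + \<theta> (K x) * \<theta> (K y))"

text \<open>
  \<open>lee_derivative\<close> and \<open>reduced_metric_derivative\<close> will turn out to be the covariant derivatives
  \<open>(N\<^sub>x \<theta>) y\<close> and \<open>(N\<^sub>x ghat)(y, z)\<close> for the Levi-Civita connection \<open>N\<close> of the local hyperkaehler
  metric.
\<close>

definition lee_derivative :: "('v \<Rightarrow> 'v \<Rightarrow> real) \<Rightarrow> ('v \<Rightarrow> real) \<Rightarrow> 'v \<Rightarrow> 'v \<Rightarrow> real" where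
  "lee_derivative g \<theta> x y = \<theta> x * \<theta> y - g x y / 2"

definition reduced_metric_derivative :: "('v \<Rightarrow> 'v \<Rightarrow> real) \<Rightarrow> ('v \<Rightarrow> real) \<Rightarrow>
    ('v \<Rightarrow> 'v) \<Rightarrow> ('v \<Rightarrow> 'v) \<Rightarrow> ('v \<Rightarrow> 'v) \<Rightarrow> 'v \<Rightarrow> 'v \<Rightarrow> 'v \<Rightarrow> real" where
  "reduced_metric_derivative g \<theta> I J K x y z = \<theta> x * g y z - 1/2 *
     (lee_derivative g \<theta> x y * \<theta> z + \<theta> y * lee_derivative g \<theta> x z +
      lee_derivative g \<theta> x (I y) * \<theta> (I z) + \<theta> (I y) * lee_derivative g \<theta> x (I z) +
      lee_derivative g \<theta> x (J y) * \<theta> (J z) + \<theta> (J y) * lee_derivative g \<theta> x (J z) +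
      lee_derivative g \<theta> x (K y) * \<theta> (K z) + \<theta> (K y) * lee_derivative g \<theta> x (K z))"

text \<open>The quaternion relations leave at most one structure on each vector, and invariance
  moves it to the second argument of \<open>g\<close>; both sides then become the same polynomial in
  values of \<open>g\<close> and \<open>\<theta>\<close>. The forms \<open>\<alpha>\<close>,
  \<open>\<beta>\<close>, \<open>\<gamma>\<close> are the three images of half the Lee form.\<close>

lemma reduced_metric_torsion_identity:
  fixes g :: "'v::real_vector \<Rightarrow> 'v \<Rightarrow> real" and \<theta> :: "'v \<Rightarrow> real" and I J K :: "'v \<Rightarrow> 'v"
    and x y z :: 'v
  defines "Q \<equiv> reduced_metric_derivative g \<theta> I J K"
  defines "k \<equiv> \<lambda>x y z. Q x y z + Q y x z - Q z x y"
    and "h \<equiv> reduced_metric g \<theta> I J K"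
    and "\<alpha> \<equiv> \<lambda>x. - (\<theta> (I x) / 2)" and "\<beta> \<equiv> \<lambda>x. - (\<theta> (J x) / 2)" and "\<gamma> \<equiv> \<lambda>x. - (\<theta> (K x) / 2)"
  assumes bil: "bilinear g" and sym: "\<And>u v. g u v = g v u"
    and inv: "\<And>u v. g (I u) (I v) = g u v" "\<And>u v. g (J u) (J v) = g u v"
      "\<And>u v. g (K u) (K v) = g u v"
    and \<theta>: "linear \<theta>" and lin: "linear I" "linear J" "linear K"
    and sq: "\<And>u. I (I u) = - u" "\<And>u. J (J u) = - u" "\<And>u. K (K u) = - u"
    and IJ: "\<And>u. I (J u) = K u" "\<And>u. J (I u) = - K u"
  shows "k (I x) (I y) z + k (I x) y (I z) + k (I y) (I z) x + k (I y) z (I x)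
      + k (I z) (I x) y + k (I z) x (I y) =
    2 * (wedge_1_2 \<alpha> (\<lambda>u v. h (I u) v) x y z + wedge_1_2 \<beta> (\<lambda>u v. h (J u) v) x y z
      + wedge_1_2 \<gamma> (\<lambda>u v. h (K u) v) x y z - 2 * wedge_1_2 \<alpha> (wedge_1_1 \<beta> \<gamma>) x y z)"
proof -
  have neg: "\<And>u v. g (- u) v = - g u v" "\<And>u v. g u (- v) = - g u v"
    using bilinear_lneg[OF bil] bilinear_rneg[OF bil] by auto
  have neg': "\<theta> (- u) = - \<theta> u" "I (- u) = - I u" "J (- u) = - J u" "K (- u) = - K u" for u
    using linear_neg \<theta> lin by auto
  have prods: "I (K u) = - J u" "K (I u) = J u" "J (K u) = I u" "K (J u) = - I u" for u
    using IJ sq neg' by (metis minus_minus)+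
  have move: "g (I u) v = - g u (I v)" "g (J u) v = - g u (J v)" "g (K u) v = - g u (K v)" for u v
    using inv[of u] inv(1)[of "I u" v] inv(2)[of "J u" v] inv(3)[of "K u" v] sq neg by auto
  \<comment> \<open>Instantiated below at the three pairs among \<open>x\<close>, \<open>y\<close>,
    \<open>z\<close>, this fixes one order for each pair.\<close>
  have swap: "g v u = g u v" "g v (I u) = - g u (I v)" "g v (J u) = - g u (J v)"
    "g v (K u) = - g u (K v)" for u v
    using sym move by metis+
  show ?thesis
    unfolding k_def Q_def h_def \<alpha>_def \<beta>_def \<gamma>_def wedge_1_1_def wedge_1_2_def
      reduced_metric_def reduced_metric_derivative_def lee_derivative_def
    by (simp add: sq IJ prods neg neg' move swap[of x y] swap[of y z] swap[of x z] field_simps)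
qed


section \<open>The torsion near a point\<close>

text \<open>The global data together with one member \<open>(U, f, h)\<close> of the cover. Vector
  fields remain global, as \<open>nabla\<close> needs, and are restricted to \<open>U\<close>
  whenever \<open>N\<close> is applied.\<close>

locale vaisman_patch = smooth_atlas A
  for A :: "('m::{t2_space, second_countable_topology}, 'e::euclidean_space) chart set" +
  fixes g h :: "'m \<Rightarrow> 'e \<Rightarrow> 'e \<Rightarrow> real" and I1 I2 I3 :: "'m \<Rightarrow> 'e \<Rightarrow> 'e" and \<theta> :: "'m \<Rightarrow> 'e \<Rightarrow> real"
    and f :: "'m \<Rightarrow> real" and U :: "'m set" and V :: "'m \<Rightarrow> 'e" and nabla N :: "('m, 'e) connection"
  assumes hyperhermitian_g: "hyperhermitian A UNIV g I1 I2 I3"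
    and riemannian_h: "riemannian_metric A U h"
    and levi_civita_h: "levi_civita A U h N"
    and parallel_h: "\<And>J. J \<in> {I1, I2, I3} \<Longrightarrow> parallel_endomorphism A U N J"
    and open_U: "open U" and smooth_f: "smooth_fun A U f"
    and conformal: "\<And>p u v. p \<in> U \<Longrightarrow> g p u v = exp (f p) * h p u v"
    and one_form: "one_form A UNIV \<theta>"
    and lee: "\<And>p u. p \<in> U \<Longrightarrow> \<theta> p u = differential A f p u"
    and levi_civita_g: "levi_civita A UNIV g nabla"
    and parallel_lee: "parallel_one_form A UNIV nabla \<theta>"
    and dual: "metric_dual A g \<theta> V" and unit: "\<And>p. g p (V p) (V p) = 1"
begin

lemma riemannian_g: "riemannian_metric A UNIV g"
  using hyperhermitian_g unfolding hyperhermitian_def by blast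

lemma bilinear_g: "bilinear (g p)" and sym_g: "g p u v = g p v u"
  using riemannian_g unfolding riemannian_metric_def by blast+

lemma linear_lee: "linear (\<theta> p)"
  using one_form unfolding one_form_def by blast

lemma endomorphism:
  assumes "J \<in> {I1, I2, I3}"
  shows "endomorphism_field A UNIV J" "J p (J p u) = - u" "linear (J p)" "g p (J p u) (J p v) = g p u v"
proof -
  show "endomorphism_field A UNIV J" "J p (J p u) = - u" "g p (J p u) (J p v) = g p u v"
    using assms hyperhermitian_g
    unfolding hyperhermitian_def hypercomplex_def integrable_complex_structure_def by blast+
  then show "linear (J p)"
    unfolding endomorphism_field_def by blast
qed

lemma quaternion: "I1 p (I2 p u) = I3 p u" "I2 p (I1 p u) = - I3 p u"
  using hyperhermitian_g unfolding hyperhermitian_def hypercomplex_def by blast+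

lemma vector_field_U: "vector_field A UNIV X \<Longrightarrow> vector_field A U X"
  by (erule vector_field_subset) simp

lemma vector_field_J: "J \<in> {I1, I2, I3} \<Longrightarrow> vector_field A UNIV X \<Longrightarrow> vector_field A UNIV (\<lambda>q. J q (X q))"
  by (rule vector_field_endomorphism[OF endomorphism(1)]) auto

section \<open>Covariant derivatives and torsion on the patch\<close>

text \<open>\<open>N\<close> preserves \<open>h\<close>, and differentiating the factor
  \<open>exp (f p)\<close> contributes the Lee form. Thus \<open>N\<close> is a Weyl connection for
  \<open>g\<close>.\<close>

lemma differential_metric:
  assumes p: "p \<in> U" and X: "vector_field A UNIV X" and Y: "vector_field A UNIV Y"
    and Z: "vector_field A UNIV Z"
  shows "differential A (\<lambda>q. g q (Y q) (Z q)) p (X p) =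
    \<theta> p (X p) * g p (Y p) (Z p) + g p (N X Y p) (Z p) + g p (Y p) (N X Z p)"
proof -
  let ?c = "chart_at A p" and ?h = "\<lambda>q. h q (Y q) (Z q)"
  let ?x = "snd ?c p"
  have x: "chart_inv ?c ?x = p"
    by (rule chart_inv_chart[OF chart_at])
  have df: "((\<lambda>x. f (chart_inv ?c x)) has_derivative differential A f p) (at ?x)"
    using differential_has_derivative[OF smooth_f p] by (simp add: o_def)
  have dh: "((\<lambda>x. ?h (chart_inv ?c x)) has_derivative differential A ?h p) (at ?x)"
    using differential_has_derivative[OF smooth_fun_metric[OF riemannian_h vector_field_U
          vector_field_U open_U] p] Y Z by (simp add: o_def)
  have "((\<lambda>q. exp (f q) * ?h q) \<circ> chart_inv ?c has_derivative
      (\<lambda>v. exp (f p) * differential A ?h p v + exp (f p) * differential A f p v * ?h p)) (at ?x)"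
    unfolding o_def by (rule derivative_eq_intros df dh refl)+ (simp add: x algebra_simps)
  from differential_eqI[OF this open_U p, of "\<lambda>q. g q (Y q) (Z q)" "X p"]
  have "differential A (\<lambda>q. g q (Y q) (Z q)) p (X p) =
      exp (f p) * differential A ?h p (X p) + exp (f p) * differential A f p (X p) * ?h p"
    by (simp add: conformal)
  moreover have "differential A ?h p (X p) - h p (N X Y p) (Z p) - h p (Y p) (N X Z p) = 0"
    using levi_civita_h p X Y Z vector_field_U
    unfolding levi_civita_def parallel_metric_def by blast
  ultimately show ?thesis
    using p by (simp add: conformal lee algebra_simps)
qed

text \<open>As \<open>\<theta>\<close> is parallel for \<open>nabla\<close>, its derivative under
  \<open>N\<close> is \<open>\<theta>\<close> applied to the difference \<open>a\<close> of the
  connections, that is, the component of \<open>a\<close> along \<open>V\<close>.\<close>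

lemma differential_lee:
  assumes p: "p \<in> U" and X: "vector_field A UNIV X" and Y: "vector_field A UNIV Y"
  shows "differential A (\<lambda>q. \<theta> q (Y q)) p (X p) =
    \<theta> p (N X Y p) + lee_derivative (g p) (\<theta> p) (X p) (Y p)"
proof -
  define a where "a X Y = nabla X Y p - N X Y p" for X Y
  have V: "vector_field A UNIV V" and gV: "g p (V p) u = \<theta> p u" for u
    using dual unfolding metric_dual_def by auto
  \<comment> \<open>\<open>nabla\<close> preserves \<open>g\<close> while \<open>N\<close> scales it
    by the Lee form; subtracting the two product rules gives the defect of \<open>a\<close>.\<close>
  have compat: "g p (a X Y) (Z p) + g p (Y p) (a X Z) = \<theta> p (X p) * g p (Y p) (Z p)"
    if "vector_field A UNIV X" "vector_field A UNIV Y" "vector_field A UNIV Z" for X Y Z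
  proof -
    have "differential A (\<lambda>q. g q (Y q) (Z q)) p (X p) - g p (nabla X Y p) (Z p)
        - g p (Y p) (nabla X Z p) = 0"
      using levi_civita_g that unfolding levi_civita_def parallel_metric_def by blast
    then show ?thesis
      using differential_metric[OF p that]
      by (simp add: a_def bilinear_lsub[OF bilinear_g] bilinear_rsub[OF bilinear_g])
  qed
  have symm: "a X Y = a Y X" if "vector_field A UNIV X" "vector_field A UNIV Y" for X Y
  proof -
    have "torsion A nabla X Y p = 0" "torsion A N X Y p = 0"
      using levi_civita_g levi_civita_h that p vector_field_U unfolding levi_civita_def by blast+
    then show ?thesis
      by (simp add: a_def torsion_def algebra_simps)
  qed
  have gV': "g p u (V p) = \<theta> p u" for u
    using sym_g gV by metis
  txt \<open>The Koszul trick for the difference \<open>a\<close> of the two connections, with third field \<open>V\<close>.\<close>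
  have "g p (a X Y) (V p) + g p (Y p) (a X V) = \<theta> p (X p) * \<theta> p (Y p)"
    using compat[OF X Y V] gV' by simp
  moreover have "g p (a X Y) (V p) + g p (X p) (a Y V) = \<theta> p (Y p) * \<theta> p (X p)"
    using compat[OF Y X V] symm[OF X Y] gV' by simp
  \<comment> \<open>The unit length enters here, as \<open>\<theta> p (V p) = 1\<close>.\<close>
  moreover have "g p (Y p) (a X V) + g p (X p) (a Y V) = g p (X p) (Y p)"
    using compat[OF V X Y] symm[OF X V] symm[OF Y V] gV'[of "V p"] unit[of p]
      sym_g[of p "a V X" "Y p"] by simp
  ultimately have "2 * g p (a X Y) (V p) = 2 * (\<theta> p (X p) * \<theta> p (Y p)) - g p (X p) (Y p)"
    by (simp add: mult.commute)
  moreover have "g p (a X Y) (V p) = \<theta> p (nabla X Y p) - \<theta> p (N X Y p)"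
    using gV' linear_diff[OF linear_lee] by (simp add: a_def)
  moreover have "differential A (\<lambda>q. \<theta> q (Y q)) p (X p) - \<theta> p (nabla X Y p) = 0"
    using parallel_lee X Y unfolding parallel_one_form_def by blast
  ultimately show ?thesis
    by (simp add: lee_derivative_def field_simps)
qed

abbreviation "ghat \<equiv> \<lambda>q. reduced_metric (g q) (\<theta> q) (I1 q) (I2 q) (I3 q)"

lemma N_endomorphism:
  assumes "p \<in> U" "J \<in> {I1, I2, I3}" "vector_field A UNIV X" "vector_field A UNIV Y"
  shows "N X (\<lambda>q. J q (Y q)) p = J p (N X Y p)"
  using parallel_h[OF assms(2)] assms vector_field_U unfolding parallel_endomorphism_def by fastforce

text \<open>The product rule. Since \<open>N\<close> commutes with each structure, the derivative of
  \<open>\<theta>\<close> on a rotated field is again given by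
  \<open>differential_lee\<close>.\<close>

lemma differential_reduced_metric:
  assumes p: "p \<in> U" and X: "vector_field A UNIV X" and Y: "vector_field A UNIV Y"
    and Z: "vector_field A UNIV Z"
  shows "differential A (\<lambda>q. ghat q (Y q) (Z q)) p (X p) =
    ghat p (N X Y p) (Z p) + ghat p (Y p) (N X Z p) +
    reduced_metric_derivative (g p) (\<theta> p) (I1 p) (I2 p) (I3 p) (X p) (Y p) (Z p)"
proof -
  let ?c = "chart_at A p"
  let ?x = "snd ?c p"
  have x: "chart_inv ?c ?x = p"
    by (rule chart_inv_chart[OF chart_at])
  let ?d = "\<lambda>W. differential A (\<lambda>q. \<theta> q (W q)) p"
  have dg: "((\<lambda>x. g (chart_inv ?c x) (Y (chart_inv ?c x)) (Z (chart_inv ?c x))) has_derivative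
      differential A (\<lambda>q. g q (Y q) (Z q)) p) (at ?x)"
    using differential_has_derivative[OF smooth_fun_metric[OF riemannian_g Y Z]] by (simp add: o_def)
  have d\<theta>: "((\<lambda>x. \<theta> (chart_inv ?c x) (W (chart_inv ?c x))) has_derivative ?d W) (at ?x)"
    if "vector_field A UNIV W" for W
    using differential_has_derivative[OF smooth_fun_one_form[OF one_form that]] by (simp add: o_def)
  note dJ = d\<theta>[OF vector_field_J]
  note d = dg d\<theta>[OF Y] d\<theta>[OF Z] dJ[OF _ Y, of I1] dJ[OF _ Y, of I2] dJ[OF _ Y, of I3]
    dJ[OF _ Z, of I1] dJ[OF _ Z, of I2] dJ[OF _ Z, of I3]
  have "((\<lambda>q. ghat q (Y q) (Z q)) \<circ> chart_inv ?c has_derivative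
      (\<lambda>v. differential A (\<lambda>q. g q (Y q) (Z q)) p v - 1/2 *
        (?d Y v * \<theta> p (Z p) + \<theta> p (Y p) * ?d Z v +
         ?d (\<lambda>q. I1 q (Y q)) v * \<theta> p (I1 p (Z p)) + \<theta> p (I1 p (Y p)) * ?d (\<lambda>q. I1 q (Z q)) v +
         ?d (\<lambda>q. I2 q (Y q)) v * \<theta> p (I2 p (Z p)) + \<theta> p (I2 p (Y p)) * ?d (\<lambda>q. I2 q (Z q)) v +
         ?d (\<lambda>q. I3 q (Y q)) v * \<theta> p (I3 p (Z p)) + \<theta> p (I3 p (Y p)) * ?d (\<lambda>q. I3 q (Z q)) v)))
      (at ?x)"
    unfolding o_def reduced_metric_def
    by (rule derivative_eq_intros d refl insertI1 insertI2)+ (simp add: x algebra_simps)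
  from differential_eqI[OF this, of UNIV "\<lambda>q. ghat q (Y q) (Z q)" "X p"] show ?thesis
    using differential_metric[OF p X Y Z] differential_lee[OF p X] vector_field_J Y Z
      N_endomorphism[OF p _ X]
    by (simp add: reduced_metric_def reduced_metric_derivative_def algebra_simps)
qed

text \<open>Apply \<open>hermitian_torsion_formula\<close> on the set of global fields, with
  \<open>I1\<close> as the complex structure and \<open>B\<close> the difference of \<open>D\<close>
  and \<open>N\<close> lowered by \<open>ghat\<close>.\<close>

lemma HKT_torsion:
  assumes p: "p \<in> U" and HKT: "HKT_connection A ghat I1 I2 I3 D"
    and X: "vector_field A UNIV X" and Y: "vector_field A UNIV Y" and Z: "vector_field A UNIV Z"
  defines "\<alpha> \<equiv> \<lambda>J u. - (\<theta> p (J p u) / 2)" and "\<phi> \<equiv> \<lambda>J u v. ghat p (J p u) v"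
  shows "torsion_form A ghat D X Y Z p =
    - (wedge_1_2 (\<alpha> I1) (\<phi> I1) (X p) (Y p) (Z p) + wedge_1_2 (\<alpha> I2) (\<phi> I2) (X p) (Y p) (Z p)
      + wedge_1_2 (\<alpha> I3) (\<phi> I3) (X p) (Y p) (Z p)
      - 2 * wedge_1_2 (\<alpha> I1) (wedge_1_1 (\<alpha> I2) (\<alpha> I3)) (X p) (Y p) (Z p))"
proof -
  define B where "B X Y Z = ghat p (D X Y p - N X Y p) (Z p)" for X Y Z
  define Q where "Q X Y Z = reduced_metric_derivative (g p) (\<theta> p) (I1 p) (I2 p) (I3 p) (X p) (Y p) (Z p)"
    for X Y Z :: "'m \<Rightarrow> 'e"
  define J where "J X = (\<lambda>q. I1 q (X q))" for X :: "'m \<Rightarrow> 'e"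
  let ?S = "Collect (vector_field A UNIV)"
  have ghat: "bilinear (ghat p)" "\<And>u v. ghat p u v = ghat p v u"
      "\<And>u v. ghat p (I1 p u) (I1 p v) = ghat p u v"
    using HKT unfolding HKT_connection_def hyperhermitian_def riemannian_metric_def by blast+
  note ghat_simps = bilinear_lsub[OF ghat(1)] bilinear_rsub[OF ghat(1)] bilinear_lneg[OF ghat(1)]
    bilinear_rneg[OF ghat(1)]
  have skew_ghat: "ghat p (I1 p u) v = - ghat p u (I1 p v)" for u v
    using ghat(3)[of u "I1 p v"] endomorphism(2)[of I1 p v] by (simp add: ghat_simps)
  have JS: "J X \<in> ?S" if "X \<in> ?S" for X
    using that vector_field_J[of I1 X] by (simp add: J_def)
  \<comment> \<open>Both connections commute with \<open>I1\<close>, hence so does their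
    difference.\<close>
  have BJ: "B X (J Y) Z = ghat p (I1 p (D X Y p - N X Y p)) (Z p)" if "X \<in> ?S" "Y \<in> ?S" for X Y Z
  proof -
    have "D X (J Y) p - I1 p (D X Y p) = 0"
      using HKT that unfolding HKT_connection_def parallel_endomorphism_def J_def by blast
    then show ?thesis
      using N_endomorphism[OF p, of I1 X Y] that linear_diff[OF endomorphism(3)[of I1 p]]
      by (simp add: B_def J_def)
  qed
  \<comment> \<open>\<open>N\<close> is torsion-free, so the torsion of \<open>D\<close> is the skew
    part of the difference.\<close>
  have torsion: "torsion_form A ghat D X Y Z p = B X Y Z - B Y X Z" if "X \<in> ?S" "Y \<in> ?S" for X Y Z
  proof -
    have "torsion A N X Y p = 0"
      using levi_civita_h that p vector_field_U unfolding levi_civita_def by blast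
    then have "torsion A D X Y p = (D X Y p - N X Y p) - (D Y X p - N Y X p)"
      by (simp add: torsion_def algebra_simps)
    then show ?thesis
      by (simp only: torsion_form_def B_def bilinear_lsub[OF ghat(1)])
  qed
  have "2 * (B X Y Z - B Y X Z) =
    - (Q (J X) (J Y) Z + Q (J Y) (J X) Z - Q Z (J X) (J Y)
     + (Q (J X) Y (J Z) + Q Y (J X) (J Z) - Q (J Z) (J X) Y)
     + (Q (J Y) (J Z) X + Q (J Z) (J Y) X - Q X (J Y) (J Z))
     + (Q (J Y) Z (J X) + Q Z (J Y) (J X) - Q (J X) (J Y) Z)
     + (Q (J Z) (J X) Y + Q (J X) (J Z) Y - Q Y (J Z) (J X))
     + (Q (J Z) X (J Y) + Q X (J Z) (J Y) - Q (J Y) (J Z) X))"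
  proof (rule hermitian_torsion_formula[of ?S J B Q, OF JS])
    fix X Y Z assume S: "X \<in> ?S" "Y \<in> ?S" "Z \<in> ?S"
    have "differential A (\<lambda>q. ghat q (Y q) (Z q)) p (X p) - ghat p (D X Y p) (Z p)
        - ghat p (Y p) (D X Z p) = 0"
      using HKT S unfolding HKT_connection_def parallel_metric_def by blast
    \<comment> \<open>\<open>D\<close> preserves \<open>ghat\<close>, whereas its derivative under
      \<open>N\<close> is \<open>Q\<close>.\<close>
    then show "B X Y Z + B X Z Y = Q X Y Z"
      using differential_reduced_metric[OF p, of X Y Z] S ghat(2)[of "D X Z p" "Y p"]
        ghat(2)[of "N X Z p" "Y p"]
      by (simp add: B_def Q_def ghat_simps)
    show "B X (J Y) Z = - B X Y (J Z)"
      using BJ[OF S(1,2), of Z] skew_ghat by (simp add: B_def J_def)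
    show "B X (J Y) (J Z) = B X Y Z"
      using BJ[OF S(1,2), of "J Z"] ghat(3) by (simp add: B_def J_def)
    have "torsion_form A ghat D X Y Z p = - torsion_form A ghat D X Z Y p"
      using HKT S unfolding HKT_connection_def three_form_def by blast
    then show "B X Y Z - B Y X Z = - (B X Z Y - B Z X Y)"
      using torsion S by simp
  qed (use X Y Z in auto)
  then show ?thesis
    using X Y Z torsion[of X Y Z] reduced_metric_torsion_identity[OF bilinear_g[of p] sym_g[of p]
        endomorphism(4)[of I1 p] endomorphism(4)[of I2 p] endomorphism(4)[of I3 p] linear_lee[of p]
        endomorphism(3)[of I1 p] endomorphism(3)[of I2 p] endomorphism(3)[of I3 p]
        endomorphism(2)[of I1 p] endomorphism(2)[of I2 p] endomorphism(2)[of I3 p]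
        quaternion[of p], of "X p" "Y p" "Z p"]
    by (simp add: Q_def J_def \<alpha>_def \<phi>_def)
qed

text \<open>Each structure is skew for \<open>g\<close>, so \<open>\<theta>\<close> vanishes on the
  rotated copies of \<open>V\<close>; since \<open>\<theta> p (V p) = 1\<close>, only half of
  \<open>\<theta>\<close> is subtracted.\<close>

lemma reduced_metric_dual: "ghat p (V p) u = 1/2 * \<theta> p u"
proof -
  have gV: "g p (V p) u = \<theta> p u" for u
    using dual unfolding metric_dual_def by auto
  have "\<theta> p (J p (V p)) = 0" if "J \<in> {I1, I2, I3}" for J
    using endomorphism(2,4)[OF that, of p "V p"] endomorphism(4)[OF that, of p "V p" "J p (V p)"]
      gV[of "J p (V p)"] sym_g[of p "J p (V p)" "V p"] bilinear_rneg[OF bilinear_g, of p]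
    by simp
  then show ?thesis
    using gV[of "V p"] unit[of p] by (simp add: reduced_metric_def gV)
qed

end


section \<open>From patches to the whole manifold\<close>

theorem lemma18:
  fixes A :: "('m::{t2_space, second_countable_topology}, 'e::euclidean_space) chart set"
    and g ghat :: "'m \<Rightarrow> 'e \<Rightarrow> 'e \<Rightarrow> real"
    and I1 I2 I3 :: "'m \<Rightarrow> 'e \<Rightarrow> 'e"
    and \<theta> \<theta>1 \<theta>2 \<theta>3 \<theta>hat \<theta>hat1 \<theta>hat2 \<theta>hat3 :: "'m \<Rightarrow> 'e \<Rightarrow> real"
    and Fhat1 Fhat2 Fhat3 :: "'m \<Rightarrow> 'e \<Rightarrow> 'e \<Rightarrow> real"
    and V :: "'m \<Rightarrow> 'e"
    and nabla D :: "('m, 'e) connection"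
  assumes "smooth_manifold A"
    and "locally_conformally_hyperkaehler A g I1 I2 I3"
    and "lee_form A g I1 I2 I3 \<theta>"
    and "levi_civita A UNIV g nabla"
    and "parallel_one_form A UNIV nabla \<theta>"
    and "metric_dual A g \<theta> V"
    and unit_length: "\<forall>p. sqrt (g p (V p) (V p)) = 1"
    and "\<theta>1 = act_one_form I1 \<theta>"
    and "\<theta>2 = act_one_form I2 \<theta>"
    and "\<theta>3 = act_one_form I3 \<theta>"
    and "ghat = (\<lambda>p u v. g p u v -
           1/2 * (\<theta> p u * \<theta> p v + \<theta>1 p u * \<theta>1 p v + \<theta>2 p u * \<theta>2 p v + \<theta>3 p u * \<theta>3 p v))"
    and "\<theta>hat = (\<lambda>p u. ghat p (V p) u)"
    and "\<theta>hat1 = act_one_form I1 \<theta>hat"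
    and "\<theta>hat2 = act_one_form I2 \<theta>hat"
    and "\<theta>hat3 = act_one_form I3 \<theta>hat"
    and "Fhat1 = fundamental_form ghat I1"
    and "Fhat2 = fundamental_form ghat I2"
    and "Fhat3 = fundamental_form ghat I3"
    and "HKT_connection A ghat I1 I2 I3 D"
  shows "(\<forall>p u. \<theta>hat p u = 1/2 * \<theta> p u) \<and>
    (\<forall>X Y Z p. vector_field A UNIV X \<and> vector_field A UNIV Y \<and> vector_field A UNIV Z \<longrightarrow>
       torsion_form A ghat D X Y Z p =
         - (wedge_1_2 (\<theta>hat1 p) (Fhat1 p) (X p) (Y p) (Z p)
            + wedge_1_2 (\<theta>hat2 p) (Fhat2 p) (X p) (Y p) (Z p)
            + wedge_1_2 (\<theta>hat3 p) (Fhat3 p) (X p) (Y p) (Z p)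
            - 2 * wedge_1_2 (\<theta>hat1 p) (wedge_1_1 (\<theta>hat2 p) (\<theta>hat3 p)) (X p) (Y p) (Z p)))"
proof -
  interpret smooth_atlas A
    using assms(1) by unfold_locales
  have hh: "hyperhermitian A UNIV g I1 I2 I3"
    using assms(2) unfolding locally_conformally_hyperkaehler_def by blast
  obtain C where one: "one_form A UNIV \<theta>" and C: "hyperkaehler_cover A g I1 I2 I3 C"
    and lee: "\<forall>(U, f, h)\<in>C. \<forall>p\<in>U. \<forall>u. \<theta> p u = differential A f p u"
    using assms(3) unfolding lee_form_def by blast
  \<comment> \<open>\<open>U\<close>, \<open>f\<close>, \<open>h\<close> and \<open>N\<close> depend
    on the point, but the torsion formula mentions none of them, so nothing has to be glued.\<close>
  have patch: "\<exists>U f h N. p \<in> U \<and> vaisman_patch A g h I1 I2 I3 \<theta> f U V nabla N" for p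
  proof -
    obtain U f h where Ufh: "(U, f, h) \<in> C" and p: "p \<in> U"
      using C unfolding hyperkaehler_cover_def by blast
    have U: "open U" "smooth_fun A U f" "hyperkaehler A U h I1 I2 I3"
      and conf: "\<forall>p\<in>U. \<forall>u v. g p u v = exp (f p) * h p u v"
      using C Ufh unfolding hyperkaehler_cover_def by blast+
    obtain N where N: "levi_civita A U h N" "\<forall>J\<in>{I1, I2, I3}. parallel_endomorphism A U N J"
      using U(3) unfolding hyperkaehler_def by blast
    have h: "riemannian_metric A U h"
      using U(3) unfolding hyperkaehler_def hyperhermitian_def by blast
    have lee_p: "\<forall>p\<in>U. \<forall>u. \<theta> p u = differential A f p u"
      using lee Ufh by blast
    have unit: "g p (V p) (V p) = 1" for p
      using unit_length by simp
    have "vaisman_patch A g h I1 I2 I3 \<theta> f U V nabla N"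
    proof
      show "parallel_endomorphism A U N J" if "J \<in> {I1, I2, I3}" for J
        using N(2) that by blast
      show "g p u v = exp (f p) * h p u v" if "p \<in> U" for p u v
        using conf that by blast
      show "\<theta> p u = differential A f p u" if "p \<in> U" for p u
        using lee_p that by blast
    qed (fact hh h N(1) U(1,2) one assms(4-6) unit)+
    with p show ?thesis
      by blast
  qed
  have ghat: "ghat = (\<lambda>q. reduced_metric (g q) (\<theta> q) (I1 q) (I2 q) (I3 q))"
    unfolding assms(8-11) reduced_metric_def act_one_form_def by simp
  have \<theta>hat: "\<theta>hat p u = 1/2 * \<theta> p u" for p u
  proof -
    \<comment> \<open>Any patch will do: \<open>reduced_metric_dual\<close> does not restrict its
      point to \<open>U\<close>.\<close>
    obtain U f h N where "vaisman_patch A g h I1 I2 I3 \<theta> f U V nabla N"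
      using patch by blast
    then show ?thesis
      unfolding assms(12) ghat by (rule vaisman_patch.reduced_metric_dual)
  qed
  have hats: "\<theta>hat1 p = (\<lambda>u. - (\<theta> p (I1 p u) / 2))" "\<theta>hat2 p = (\<lambda>u. - (\<theta> p (I2 p u) / 2))"
    "\<theta>hat3 p = (\<lambda>u. - (\<theta> p (I3 p u) / 2))" for p
    unfolding assms(13-15) by (simp_all add: act_one_form_def[abs_def] \<theta>hat)
  have Fhats: "Fhat1 p = (\<lambda>u v. ghat p (I1 p u) v)" "Fhat2 p = (\<lambda>u v. ghat p (I2 p u) v)"
    "Fhat3 p = (\<lambda>u v. ghat p (I3 p u) v)" for p
    unfolding assms(16-18) by (simp_all add: fundamental_form_def[abs_def])
  show ?thesis
  proof (intro conjI allI impI)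
    fix X Y Z p assume XYZ: "vector_field A UNIV X \<and> vector_field A UNIV Y \<and> vector_field A UNIV Z"
    obtain U f h N where p: "p \<in> U" and "vaisman_patch A g h I1 I2 I3 \<theta> f U V nabla N"
      using patch by blast
    then interpret vaisman_patch A g h I1 I2 I3 \<theta> f U V nabla N
      by blast
    show "torsion_form A ghat D X Y Z p =
         - (wedge_1_2 (\<theta>hat1 p) (Fhat1 p) (X p) (Y p) (Z p)
            + wedge_1_2 (\<theta>hat2 p) (Fhat2 p) (X p) (Y p) (Z p)
            + wedge_1_2 (\<theta>hat3 p) (Fhat3 p) (X p) (Y p) (Z p)
            - 2 * wedge_1_2 (\<theta>hat1 p) (wedge_1_1 (\<theta>hat2 p) (\<theta>hat3 p)) (X p) (Y p) (Z p))"
      unfolding hats Fhats ghat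
      using XYZ assms(19)[unfolded ghat] by (intro HKT_torsion[OF p]) simp_all
  qed (rule \<theta>hat)
qed

end
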